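(* For every integer $n\geq 4$, the modular $2$-group $$\mathrm{M}_{2^n}=\langle x,y: x^{2^{n-1}}=y^2=1,\ y^{-1}xy=x^{2^{n-2}+1}\rangle$$ is harmonious.
   Context: A finite group $G$ of order $N$ is harmonious if there is a repetition-free ordered list $(g_1,g_2,\ldots,g_N)$ of all elements of $G$ such that the $N$ group elements $g_1g_2,\,g_2g_3,\ldots,g_{N-1}g_N,\,g_Ng_1$ are pairwise distinct. *)

theory Defs
  imports "HOL-Algebra.Coset"
begin

(* For N = length gs, the entry with index i is g_(i+1); reducing Suc i modulo N makes the
   last product g_N g_1. *)
definition harmonious :: "('a, 'b) monoid_scheme \<Rightarrow> bool" where
  "harmonious G \<longleftrightarrow>
     group G \<and> finite (carrier G) \<and>
     (\<exists>gs. length gs = order G \<and> set gs = carrier G \<and> distinct gs \<and>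
           distinct (map (\<lambda>i. gs ! i \<otimes>\<^bsub>G\<^esub> gs ! (Suc i mod length gs)) [0..<length gs]))"

(* A word in the generators 'g and their inverses: (a, True) stands for a, (a, False) for
   the inverse of a. *)
type_synonym 'g word = "('g \<times> bool) list"

(* The congruence on words generated by free cancellation and the defining relations
   u = v, (u, v) in R. *)
inductive pres_eq :: "('g word \<times> 'g word) set \<Rightarrow> 'g word \<Rightarrow> 'g word \<Rightarrow> bool"
  for R where
  refl: "pres_eq R u u"
| sym: "pres_eq R u v \<Longrightarrow> pres_eq R v u"
| trans: "pres_eq R u v \<Longrightarrow> pres_eq R v w \<Longrightarrow> pres_eq R u w"
| cancel: "pres_eq R (u @ [(a, b), (a, \<not> b)] @ v) (u @ v)"
| relation: "(l, r) \<in> R \<Longrightarrow> pres_eq R (u @ l @ v) (u @ r @ v)"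

(* The group with generating set UNIV :: 'g set and defining relations R. *)
definition presented_group :: "('g word \<times> 'g word) set \<Rightarrow> 'g word set monoid" where
  "presented_group R =
     \<lparr>carrier = UNIV // {(u, v). pres_eq R u v},
      mult = (\<lambda>A B. {w. \<exists>a\<in>A. \<exists>b\<in>B. pres_eq R (a @ b) w}),
      one = {w. pres_eq R [] w}\<rparr>"

datatype xy = X | Y

definition modular_2_group :: "nat \<Rightarrow> xy word set monoid" where
  "modular_2_group n = presented_group
     {(replicate (2 ^ (n - 1)) (X, True), []),
      (replicate 2 (Y, True), []),
      ([(Y, False), (X, True), (Y, True)], replicate (2 ^ (n - 2) + 1) (X, True))}"

lemma pres_eq_append_left: "pres_eq R u v \<Longrightarrow> pres_eq R (p @ u) (p @ v)"
proof (induction rule: pres_eq.induct)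
  case (cancel u a b v) show ?case using pres_eq.cancel[of R "p @ u" a b v] by simp
next
  case (relation l r u v) then show ?case using pres_eq.relation[of l r R "p @ u" v] by simp
next
  case (refl u) show ?case by (rule pres_eq.refl)
next
  case (sym u v) show ?case using sym.IH by (rule pres_eq.sym)
next
  case (trans u v w) show ?case using trans.IH by (rule pres_eq.trans)
qed

lemma pres_eq_append_right: "pres_eq R u v \<Longrightarrow> pres_eq R (u @ p) (v @ p)"
proof (induction rule: pres_eq.induct)
  case (cancel u a b v) show ?case using pres_eq.cancel[of R u a b "v @ p"] by simp
next
  case (relation l r u v) then show ?case using pres_eq.relation[of l r R u "v @ p"] by simp
next
  case (refl u) show ?case by (rule pres_eq.refl)
next
  case (sym u v) show ?case using sym.IH by (rule pres_eq.sym)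
next
  case (trans u v w) show ?case using trans.IH by (rule pres_eq.trans)
qed

lemma pres_eq_append:
  "pres_eq R u u' \<Longrightarrow> pres_eq R v v' \<Longrightarrow> pres_eq R (u @ v) (u' @ v')"
  by (rule pres_eq.trans[OF pres_eq_append_right pres_eq_append_left])

lemma pres_eq_inverse:
  "pres_eq R (rev (map (\<lambda>(a, b). (a, \<not> b)) u) @ u) []"
proof (induction u)
  case Nil show ?case by (simp add: pres_eq.refl)
next
  case (Cons c u)
  obtain a b where "c = (a, b)" by force
  then show ?case
    using pres_eq.cancel[of R "rev (map (\<lambda>(a, b). (a, \<not> b)) u)" a "\<not> b" u] Cons
    by (simp add: pres_eq.trans)
qed

lemma group_presented_group: "group (presented_group R)"
proof -
  define c where "c u = {w. pres_eq R u w}" for u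
  have carr: "carrier (presented_group R) = range c"
    by (auto simp: presented_group_def quotient_def c_def Image_def)
  have eq: "c u = c v" if "pres_eq R u v" for u v
    using pres_eq.trans[OF that] pres_eq.trans[OF pres_eq.sym[OF that]] unfolding c_def by blast
  have one: "\<one>\<^bsub>presented_group R\<^esub> = c []"
    by (simp add: presented_group_def c_def)
  have mult: "c u \<otimes>\<^bsub>presented_group R\<^esub> c v = c (u @ v)" for u v
  proof -
    have "(\<exists>a. pres_eq R u a \<and> (\<exists>b. pres_eq R v b \<and> pres_eq R (a @ b) w)) = pres_eq R (u @ v) w" for w
    proof
      assume "\<exists>a. pres_eq R u a \<and> (\<exists>b. pres_eq R v b \<and> pres_eq R (a @ b) w)"
      then obtain a b where "pres_eq R u a" "pres_eq R v b" "pres_eq R (a @ b) w" by auto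
      then show "pres_eq R (u @ v) w" by (metis pres_eq.trans pres_eq_append)
    next
      assume "pres_eq R (u @ v) w"
      then show "\<exists>a. pres_eq R u a \<and> (\<exists>b. pres_eq R v b \<and> pres_eq R (a @ b) w)"
        using pres_eq.refl[of R u] pres_eq.refl[of R v] by auto
    qed
    then show ?thesis by (simp add: presented_group_def c_def)
  qed
  show ?thesis
  proof (rule groupI)
    fix x assume "x \<in> carrier (presented_group R)"
    then obtain u where u: "x = c u" using carr by auto
    show "\<exists>y\<in>carrier (presented_group R). y \<otimes>\<^bsub>presented_group R\<^esub> x = \<one>\<^bsub>presented_group R\<^esub>"
      using eq[OF pres_eq_inverse[of R u]] by (auto simp: u carr one mult)
  qed (auto simp: carr one mult)
qed

end

theory Submission
  imports Defs
begin

text \<open>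
  Put \<open>q = 2 ^ (n - 3)\<close>, an even number, and write \<open>E r e\<close> for the element \<open>x\<^sup>r y\<^sup>e\<close>, with \<open>r\<close>
  taken modulo \<open>4q\<close> and \<open>e\<close> modulo 2. Conjugation by \<open>y\<close> fixes the even powers of \<open>x\<close> and
  multiplies the odd ones by the central involution \<open>x\<^sup>2\<^sup>q\<close>, so
  \<open>E r e \<cdot> E s f = E (r + s + 2q [e \<and> odd s]) (e + f)\<close>.

  The square \<open>x\<^sup>2\<close> is central. Hence if a stretch of the list satisfies
  \<open>g\<^sub>i\<^sub>+\<^sub>2 = x\<^sup>2 g\<^sub>i\<close>, its products satisfy \<open>g\<^sub>i\<^sub>+\<^sub>2 g\<^sub>i\<^sub>+\<^sub>3 = x\<^sup>4 g\<^sub>i g\<^sub>i\<^sub>+\<^sub>1\<close>: along the stretch the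
  elements run through two arcs in cosets of \<open>\<langle>x\<^sup>2\<rangle>\<close>, and the products run through two cosets of
  \<open>\<langle>x\<^sup>4\<rangle>\<close>. There are eight cosets of \<open>\<langle>x\<^sup>4\<rangle>\<close>, each with \<open>q\<close> elements, so four stretches of about
  \<open>2q\<close> elements suffice in principle. The list used here is the following, with \<open>0 \<le> j < q\<close> in
  each of the blocks 0, 1, 2, 3:
    \<^item> \<open>\<dots>, x\<^bsup>2j\<^esup>, x\<^bsup>2j+2q\<^esup>, \<dots>\<close>
    \<^item> \<open>\<dots>, x\<^bsup>2j\<^esup>y, x\<^bsup>2j+2q-1\<^esup>y, \<dots>\<close>
    \<^item> \<open>\<dots>, x\<^bsup>2j+2q-2\<^esup>y, x\<^bsup>2j+2q-1\<^esup>, \<dots>\<close> with the initial \<open>x\<^bsup>2q-2\<^esup>y\<close> replaced by \<open>x\<^sup>-\<^sup>1\<close>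
    \<^item> \<open>\<dots>, x\<^bsup>2j-1\<^esup>, x\<^bsup>2j-1\<^esup>y, \<dots>\<close> with the initial \<open>x\<^sup>-\<^sup>1\<close> replaced by \<open>x\<^sup>-\<^sup>2y\<close>

  Each coset of \<open>\<langle>x\<^sup>4\<rangle>\<close> is then met by one family of products inside a block. Six of the eight
  families omit one element, and the four joins between consecutive blocks together with the
  products of the two initial pairs that contain a replaced entry supply exactly the missing ones.
  Evenness of \<open>q\<close> enters because \<open>2q\<close> must vanish modulo 4 for the eight families to lie in eight different cosets.
  Surjectivity onto the group, for the elements (\<open>elements_attained\<close>) and for the products
  (\<open>products_attained\<close>), is enough: a list of length \<open>|G|\<close> containing all of \<open>G\<close> has no
  repetition.

  That counting needs the presented group to have exactly \<open>8q\<close> elements. The relations bring every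
  word into the form \<open>x\<^sup>r y\<^sup>e\<close> with \<open>0 \<le> r < 4q\<close>, which bounds the order from above; an action of
  words on pairs \<open>(r, e)\<close> that is invariant under the relations modulo \<open>4q\<close>
  (\<open>pres_eq_action\<close>) shows that no two of these forms coincide.
\<close>

section \<open>Reduction to surjectivity\<close>

lemma harmoniousI:
  fixes G (structure)
  assumes G: "group G" and ord: "order G = N" "0 < N"
    and closed: "\<And>i. i < N \<Longrightarrow> f i \<in> carrier G"
    and elems: "\<And>z. z \<in> carrier G \<Longrightarrow> \<exists>i<N. f i = z"
    and prods: "\<And>z. z \<in> carrier G \<Longrightarrow> \<exists>i<N. f i \<otimes> f (Suc i mod N) = z"
  shows "harmonious G"
proof -
  have fin: "finite (carrier G)"
    using ord by (metis card.infinite order_def less_numeral_extra(3))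
  let ?gs = "map f [0..<N]"
  let ?ps = "map (\<lambda>i. ?gs ! i \<otimes> ?gs ! (Suc i mod length ?gs)) [0..<length ?gs]"
  have ps: "?ps = map (\<lambda>i. f i \<otimes> f (Suc i mod N)) [0..<N]"
    using ord(2) by (intro map_cong) auto
  have set_gs: "set ?gs = carrier G"
    using closed elems by (fastforce simp: image_iff)
  have "card (set ?gs) = length ?gs"
    using ord(1) unfolding set_gs by (simp add: order_def)
  then have dist_gs: "distinct ?gs" by (rule card_distinct)
  have "carrier G \<subseteq> set ?ps"
    using prods unfolding ps by (fastforce simp: image_iff)
  then have "N \<le> card (set ?ps)"
    using card_mono[of "set ?ps" "carrier G"] ord(1) by (simp add: order_def)
  then have "card (set ?ps) = length ?ps"
    using card_length[of ?ps] by simp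
  then have dist_ps: "distinct ?ps" by (rule card_distinct)
  show ?thesis
    unfolding harmonious_def
    by (intro conjI G fin exI[of _ ?gs] set_gs dist_gs dist_ps) (simp add: ord(1))
qed

section \<open>The list of exponents\<close>

text \<open>
  The entry at place \<open>j\<close> of block \<open>b\<close>, as a pair of exponents of \<open>x\<close> and \<open>y\<close>. The two values
  singled out by \<open>j = 0\<close> break the arithmetic progressions. The first arc of block 2 is
  \<open>x\<^bsup>2q\<^esup>y, \<dots>, x\<^bsup>4q-4\<^esup>y\<close>, followed by \<open>x\<^sup>-\<^sup>2y\<close> at the head of block 3, which pushes \<open>x\<^sup>-\<^sup>1\<close> out of block 3 to the head of
  block 2.
\<close>
definition block_entry :: "nat \<Rightarrow> nat \<Rightarrow> nat \<Rightarrow> bool \<Rightarrow> int \<times> bool" where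
  "block_entry q b j second =
    (if b = 0 then (if second then (2 * int j + 2 * int q, False) else (2 * int j, False))
     else if b = 1 then (if second then (2 * int j + 2 * int q - 1, True) else (2 * int j, True))
     else if b = 2 then
       (if second then (2 * int j + 2 * int q - 1, False)
        else if j = 0 then (-1, False) else (2 * int j + 2 * int q - 2, True))
     else
       (if second then (2 * int j - 1, True)
        else if j = 0 then (-2, True) else (2 * int j - 1, False)))"

definition position :: "nat \<Rightarrow> nat \<Rightarrow> nat \<Rightarrow> nat" where
  "position q b j = b * (2 * q) + 2 * j"

definition sequence_entry :: "nat \<Rightarrow> nat \<Rightarrow> int \<times> bool" where
  "sequence_entry q k = block_entry q (k div (2 * q)) (k mod (2 * q) div 2) (odd k)"

lemma sequence_entry_first:
  assumes "j < q"
  shows "sequence_entry q (position q b j) = block_entry q b j False"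
  using assms by (simp add: sequence_entry_def position_def)

lemma sequence_entry_second:
  assumes "j < q"
  shows "sequence_entry q (Suc (position q b j)) = block_entry q b j True"
proof -
  have e: "Suc (position q b j) = Suc (2 * j) + b * (2 * q)" by (simp add: position_def)
  have lt: "Suc (2 * j) < 2 * q" using assms by simp
  have "Suc (position q b j) div (2 * q) = b"
    unfolding e using lt by (subst div_mult_self1) auto
  moreover have "Suc (position q b j) mod (2 * q) = Suc (2 * j)"
    unfolding e using lt by (subst mod_mult_self1) auto
  ultimately show ?thesis by (simp add: sequence_entry_def) (simp add: position_def)
qed

lemma Suc_position_less:
  assumes "b < 4" "j < q"
  shows "Suc (position q b j) < 8 * q"
proof -
  have "Suc b * (2 * q) \<le> 4 * (2 * q)" using assms(1) by (intro mult_le_mono1) simp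
  also have "Suc b * (2 * q) = b * (2 * q) + 2 * q" by simp
  finally show ?thesis unfolding position_def using assms(2) by linarith
qed

text \<open>
  An arithmetic progression of length \<open>q\<close> and step \<open>d\<close> is a full residue class modulo \<open>d\<close> among
  the residues modulo \<open>dq\<close>. With \<open>d = 2\<close> this describes the cosets of \<open>\<langle>x\<^sup>2\<rangle>\<close> met by the
  elements, with \<open>d = 4\<close> the cosets of \<open>\<langle>x\<^sup>4\<rangle>\<close> met by the products.
\<close>
lemma arc_representative:
  fixes r c d :: int
  assumes "0 < q" "d dvd r - c"
  shows "\<exists>j<q. d * int q dvd c + d * int j - r"
proof -
  obtain t where t: "r - c = d * t" using assms(2) by (auto elim: dvdE)
  define j where "j = nat (t mod int q)"
  have j: "int j = t mod int q" using assms(1) by (simp add: j_def)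
  have "int q dvd int j - t"
    unfolding j by (simp add: mod_eq_dvd_iff[symmetric])
  then have "d * int q dvd d * (int j - t)" by (rule mult_dvd_mono[OF dvd_refl])
  moreover have "d * (int j - t) = c + d * int j - r" using t by (simp add: algebra_simps)
  moreover have "j < q" using assms(1) by (simp add: j_def nat_less_iff)
  ultimately show ?thesis by auto
qed

section \<open>Elements and products of the list\<close>

locale twisted_coordinates = group G for G (structure) +
  fixes E :: "int \<Rightarrow> bool \<Rightarrow> 'a" and q :: nat
  assumes even_q: "even q" and pos_q: "0 < q"
    and order: "order G = 8 * q"
    and carrier: "carrier G = {E r e | r e. True}"
    and mult: "E r e \<otimes> E s f = E (r + s + (if e \<and> odd s then 2 * int q else 0)) (e \<noteq> f)"
    and period: "4 * int q dvd r - s \<Longrightarrow> E r e = E s e"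
begin

definition g :: "nat \<Rightarrow> 'a" where
  "g k = (case sequence_entry q k of (r, e) \<Rightarrow> E r e)"

lemma g_first: "j < q \<Longrightarrow> g (position q b j) = (case block_entry q b j False of (r, e) \<Rightarrow> E r e)"
  by (simp add: g_def sequence_entry_first)

lemma g_second: "j < q \<Longrightarrow> g (Suc (position q b j)) = (case block_entry q b j True of (r, e) \<Rightarrow> E r e)"
  by (simp add: g_def sequence_entry_second)

lemma first_attained:
  assumes "b < 4" "j < q" "block_entry q b j False = (s, e)" "4 * int q dvd s - r"
  shows "\<exists>i<8*q. g i = E r e"
  using assms Suc_position_less[OF assms(1,2)] period[OF assms(4)]
  by (intro exI[of _ "position q b j"]) (simp add: g_first)

lemma second_attained:
  assumes "b < 4" "j < q" "block_entry q b j True = (s, e)" "4 * int q dvd s - r"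
  shows "\<exists>i<8*q. g i = E r e"
  using assms Suc_position_less[OF assms(1,2)] period[OF assms(4)]
  by (intro exI[of _ "Suc (position q b j)"]) (simp add: g_second)

text \<open>
  Each of the four cosets of \<open>\<langle>x\<^sup>2\<rangle>\<close> is the union of two arcs of length \<open>q\<close>, one starting at \<open>c\<close> and
  the other opposite to it at \<open>c + 2q\<close>; the arcs lie in different blocks, or in the same
  block for the powers of \<open>x\<^sup>2\<close>.
\<close>
lemma elements_attained: "\<exists>i<8*q. g i = E r e"
proof -
  have arc: "\<exists>j<q. 4 * int q dvd c + 2 * int j - r \<or> 4 * int q dvd c + 2 * int j + 2 * int q - r"
    if ev: "even (r - c)" for c
  proof -
    obtain j where j: "j < 2 * q" "2 * int (2 * q) dvd c + 2 * int j - r"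
      using arc_representative[OF _ ev, of "2 * q"] pos_q by auto
    show ?thesis
    proof (cases "j < q")
      case True then show ?thesis using j by auto
    next
      case False
      then have "2 * int j = 2 * int (j - q) + 2 * int q" by (simp add: of_nat_diff)
      then show ?thesis using j False by (intro exI[of _ "j - q"]) (auto simp: algebra_simps)
    qed
  qed
  show ?thesis
  proof (cases "even r"; cases e)
    assume "even r" "\<not> e"
    then obtain j where "j < q"
      "4 * int q dvd 2 * int j - r \<or> 4 * int q dvd 2 * int j + 2 * int q - r"
      using arc[of 0] by auto
    then show ?thesis
      using first_attained[of 0 j] second_attained[of 0 j] \<open>\<not> e\<close>
      by (auto simp: block_entry_def)
  next
    assume "even r" "e"
    then obtain j where "j < q"
      "4 * int q dvd 2 * int j - r \<or> 4 * int q dvd 2 * int j + 2 * int q - r"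
      using arc[of 0] by auto
    \<comment> \<open>The arc in block 2 is shifted by one place; its last element heads block 3.\<close>
    then consider "4 * int q dvd 2 * int j - r"
      | "Suc j < q" "4 * int q dvd 2 * int (Suc j) + 2 * int q - 2 - r"
      | "Suc j = q" "4 * int q dvd 2 * int j + 2 * int q - r"
      by fastforce
    then show ?thesis
    proof cases
      case 1 then show ?thesis using first_attained[of 1 j] \<open>e\<close> \<open>j < q\<close>
        by (auto simp: block_entry_def)
    next
      case 2 then show ?thesis using first_attained[of 2 "Suc j"] \<open>e\<close>
        by (auto simp: block_entry_def)
    next
      case 3
      then have q: "int q = int j + 1" by simp
      have "2 * int j + 2 * int q - r = 4 * int q + (- 2 - r)" using q by simp
      with 3 have "4 * int q dvd - 2 - r" by (metis dvd_add_triv_left_iff)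
      then show ?thesis using first_attained[of 3 0 "-2" True] \<open>e\<close> pos_q
        by (auto simp: block_entry_def)
    qed
  next
    assume "odd r" "\<not> e"
    then obtain j where j: "j < q"
      "4 * int q dvd -1 + 2 * int j - r \<or> 4 * int q dvd -1 + 2 * int j + 2 * int q - r"
      using arc[of "-1"] by auto
    have "-1 + 2 * int j + 2 * int q - r = 2 * int j + 2 * int q - 1 - r"
      "-1 + 2 * int j - r = 2 * int j - 1 - r" by simp_all
    \<comment> \<open>The element \<open>x\<^sup>-\<^sup>1\<close> belongs to the arc of block 3, but it heads block 2.\<close>
    with j consider "j = 0" "4 * int q dvd -1 - r" | "j \<noteq> 0" "4 * int q dvd 2 * int j - 1 - r"
      | "4 * int q dvd 2 * int j + 2 * int q - 1 - r"
      by (metis add.right_neutral mult_zero_right of_nat_0)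
    then show ?thesis
    proof cases
      case 1 then show ?thesis
        using first_attained[of 2 0 "-1" False r] j(1) \<open>\<not> e\<close>
        by (simp add: block_entry_def)
    next
      case 2 then show ?thesis
        using first_attained[of 3 j "2 * int j - 1" False r] j(1) \<open>\<not> e\<close>
        by (simp add: block_entry_def)
    next
      case 3 then show ?thesis
        using second_attained[of 2 j "2 * int j + 2 * int q - 1" False r] j(1) \<open>\<not> e\<close>
        by (simp add: block_entry_def)
    qed
  next
    assume "odd r" "e"
    then obtain j where j: "j < q"
      "4 * int q dvd -1 + 2 * int j - r \<or> 4 * int q dvd -1 + 2 * int j + 2 * int q - r"
      using arc[of "-1"] by auto
    have "-1 + 2 * int j + 2 * int q - r = 2 * int j + 2 * int q - 1 - r"
      "-1 + 2 * int j - r = 2 * int j - 1 - r" by simp_all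
    with j consider "4 * int q dvd 2 * int j - 1 - r"
      | "4 * int q dvd 2 * int j + 2 * int q - 1 - r"
      by metis
    then show ?thesis
    proof cases
      case 1 then show ?thesis
        using second_attained[of 3 j "2 * int j - 1" True r] j(1) \<open>e\<close>
        by (simp add: block_entry_def)
    next
      case 2 then show ?thesis
        using second_attained[of 1 j "2 * int j + 2 * int q - 1" True r] j(1) \<open>e\<close>
        by (simp add: block_entry_def)
    qed
  qed
qed

definition product :: "nat \<Rightarrow> 'a" where
  "product i = g i \<otimes> g (Suc i mod (8 * q))"

lemma product_within:
  assumes "b < 4" "j < q" "block_entry q b j False = (r, e)" "block_entry q b j True = (s, f)"
  shows "\<exists>i<8*q. product i = E (r + s + (if e \<and> odd s then 2 * int q else 0)) (e \<noteq> f)"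
  using assms Suc_position_less[OF assms(1,2)]
  by (intro exI[of _ "position q b j"]) (simp add: product_def g_first g_second mult)

lemma product_between:
  assumes "b < 4" "Suc j < q" "block_entry q b j True = (r, e)" "block_entry q b (Suc j) False = (s, f)"
  shows "\<exists>i<8*q. product i = E (r + s + (if e \<and> odd s then 2 * int q else 0)) (e \<noteq> f)"
proof -
  have "Suc (Suc (position q b j)) = position q b (Suc j)" by (simp add: position_def)
  moreover have "\<dots> < 8 * q" using Suc_position_less[OF assms(1,2)] by simp
  ultimately show ?thesis
    using assms Suc_position_less[OF assms(1), of j] g_first[of "Suc j" b] g_second[of j b]
    by (intro exI[of _ "Suc (position q b j)"]) (simp add: product_def mult)
qed

lemma product_join:
  assumes "b < 4" "block_entry q b (q - 1) True = (r, e)" "block_entry q (Suc b mod 4) 0 False = (s, f)"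
  shows "\<exists>i<8*q. product i = E (r + s + (if e \<and> odd s then 2 * int q else 0)) (e \<noteq> f)"
proof -
  have lt: "q - 1 < q" using pos_q by simp
  have "Suc (Suc (position q b (q - 1))) = position q (Suc b) 0"
    using pos_q by (cases q) (simp_all add: position_def)
  moreover have "position q (Suc b) 0 mod (8 * q) = position q (Suc b mod 4) 0"
    using mult_mod_left[of "Suc b" 4 "2 * q"] by (simp only: position_def) simp
  ultimately show ?thesis
    using assms Suc_position_less[OF assms(1) lt] g_first[OF pos_q, of "Suc b mod 4"] g_second[OF lt, of b]
    by (intro exI[of _ "Suc (position q b (q - 1))"])
      (simp add: product_def mult)
qed

lemma product_congruent:
  assumes "\<exists>i<8*q. product i = E s e" "4 * int q dvd s - r"
  shows "\<exists>i<8*q. product i = E r e"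
  using assms period by metis

text \<open>
  One case for each coset of \<open>\<langle>x\<^sup>4\<rangle>\<close>, numbered within the powers of \<open>x\<close> and within their multiples by
  \<open>y\<close>. In each case a single family of products, inside pairs or between consecutive pairs of one
  block, runs through the coset. The inner case distinctions on \<open>j\<close> isolate the one element
  that the family misses; it is the product of the initial pair of block 2 or 3, or a join of two
  blocks.
\<close>
lemma products_attained: "\<exists>i<8*q. product i = E r e"
proof -
  obtain p where p: "q = 2 * p" using even_q by auto
  have arc: "\<exists>j<q. 4 * int q dvd c + 4 * int j - r" if "4 dvd r - c" for c
    using arc_representative[OF pos_q that] by simp
  have q4: "2 * int q = 4 * int p" using p by simp
  have last: "int q = int j + 1" if "j < q" "\<not> Suc j < q" for j using that by simp
  show ?thesis
  proof (cases e)
    case False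
    have "4 dvd r - 2 * int q \<or> 4 dvd r - (2 * int q + 1)
        \<or> 4 dvd r - (2 * int q + 2) \<or> 4 dvd r - (-1)"
      unfolding q4 by presburger
    then consider "4 dvd r - 2 * int q" | "4 dvd r - (2 * int q + 1)"
      | "4 dvd r - (2 * int q + 2)" | "4 dvd r - (-1)"
      by blast
    then show ?thesis
    proof cases
      case 1
      then obtain j where j: "j < q" "4 * int q dvd 2 * int q + 4 * int j - r" using arc by blast
      have "\<exists>i<8*q. product i = E (2 * int q + 4 * int j) e"
        using product_within[of 0 j "2 * int j" False "2 * int j + 2 * int q" False] j False
        by (simp add: block_entry_def algebra_simps)
      then show ?thesis using j(2) by (rule product_congruent)
    next
      case 2
      then obtain j where j: "j < q" "4 * int q dvd 2 * int q + 1 + 4 * int j - r" using arc by blast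
      have "\<exists>i<8*q. product i = E (2 * int q + 1 + 4 * int j) e"
      proof (cases "Suc j < q")
        case True
        then show ?thesis
          using product_between[of 1 j "2 * int j + 2 * int q - 1" True "2 * int j + 2" True] False
          by (simp add: block_entry_def algebra_simps)
      next
        case nl: False
        have eq: "2 * int q - 3 - (2 * int q + 1 + 4 * int j) = - (4 * int q)"
          using last[OF j(1) nl] by simp
        have "\<exists>i<8*q. product i = E (2 * int q - 3) e"
          using product_within[of 3 0 "-2" True "-1" True] pos_q False
          by (simp add: block_entry_def algebra_simps)
        then show ?thesis
          by (rule product_congruent) (simp only: eq dvd_minus_iff dvd_refl)
      qed
      then show ?thesis using j(2) by (rule product_congruent)
    next
      case 3
      then obtain j where j: "j < q" "4 * int q dvd 2 * int q + 2 + 4 * int j - r" using arc by blast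
      have "\<exists>i<8*q. product i = E (2 * int q + 2 + 4 * int j) e"
      proof (cases "Suc j < q")
        case True
        then show ?thesis
          using product_between[of 0 j "2 * int j + 2 * int q" False "2 * int j + 2" False] False
          by (simp add: block_entry_def algebra_simps)
      next
        case nl: False
        have eq: "2 * int q - 2 - (2 * int q + 2 + 4 * int j) = - (4 * int q)"
          using last[OF j(1) nl] by simp
        have "\<exists>i<8*q. product i = E (2 * int q - 2) e"
          using product_within[of 2 0 "-1" False "2 * int q - 1" False] pos_q False
          by (simp add: block_entry_def algebra_simps)
        then show ?thesis
          by (rule product_congruent) (simp only: eq dvd_minus_iff dvd_refl)
      qed
      then show ?thesis using j(2) by (rule product_congruent)
    next
      case 4
      then obtain j where j: "j < q" "4 * int q dvd -1 + 4 * int j - r" using arc by blast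
      have "\<exists>i<8*q. product i = E (4 * int j - 1 + 4 * int q) e"
        using product_within[of 1 j "2 * int j" True "2 * int j + 2 * int q - 1" True] j False
        by (simp add: block_entry_def algebra_simps)
      then have "\<exists>i<8*q. product i = E (-1 + 4 * int j) e"
        by (rule product_congruent) simp
      then show ?thesis using j(2) by (rule product_congruent)
    qed
  next
    case True
    have "4 dvd r - 2 * int q \<or> 4 dvd r - (2 * int q - 3)
        \<or> 4 dvd r - (-2) \<or> 4 dvd r - (-1)"
      unfolding q4 by presburger
    then consider "4 dvd r - 2 * int q" | "4 dvd r - (2 * int q - 3)"
      | "4 dvd r - (-2)" | "4 dvd r - (-1)"
      by blast
    then show ?thesis
    proof cases
      case 1
      then obtain j where j: "j < q" "4 * int q dvd 2 * int q + 4 * int j - r" using arc by blast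
      have "\<exists>i<8*q. product i = E (2 * int q + 4 * int j) e"
      proof (cases "Suc j < q")
        case lt: True
        then show ?thesis
          using product_between[of 3 j "2 * int j - 1" True "2 * int j + 1" False] True
          by (simp add: block_entry_def algebra_simps)
      next
        case False
        note q = last[OF j(1) False]
        have "\<exists>i<8*q. product i = E (6 * int q - 4) e"
          using product_join[of 1 "4 * int q - 3" True "-1" False] pos_q True
          by (simp add: block_entry_def algebra_simps of_nat_diff)
        then show ?thesis
          by (rule product_congruent) (simp add: q)
      qed
      then show ?thesis using j(2) by (rule product_congruent)
    next
      case 2
      then obtain j where j: "j < q" "4 * int q dvd 2 * int q - 3 + 4 * int j - r" using arc by blast
      have "\<exists>i<8*q. product i = E (2 * int q - 3 + 4 * int j) e"
      proof (cases "j = 0")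
        case j0: True
        then show ?thesis using product_join[of 3 "2 * int q - 3" True 0 False] pos_q True
          by (simp add: block_entry_def algebra_simps of_nat_diff)
      next
        case False
        have "\<exists>i<8*q. product i = E (6 * int q - 3 + 4 * int j) e"
          using product_within[of 2 j "2 * int j + 2 * int q - 2" True "2 * int j + 2 * int q - 1" False]
            j(1) True False
          by (simp add: block_entry_def algebra_simps)
        then show ?thesis
          by (rule product_congruent) simp
      qed
      then show ?thesis using j(2) by (rule product_congruent)
    next
      case 3
      then obtain j where j: "j < q" "4 * int q dvd -2 + 4 * int j - r" using arc by blast
      have "\<exists>i<8*q. product i = E (-2 + 4 * int j) e"
      proof (cases "j = 0")
        case j0: True
        have "\<exists>i<8*q. product i = E (4 * int q - 2) e"
          using product_join[of 0 "4 * int q - 2" False 0 True] pos_q True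
          by (simp add: block_entry_def algebra_simps of_nat_diff)
        then show ?thesis
          by (rule product_congruent) (simp add: j0)
      next
        case False
        then show ?thesis
          using product_within[of 3 j "2 * int j - 1" False "2 * int j - 1" True] j(1) True
          by (simp add: block_entry_def algebra_simps)
      qed
      then show ?thesis using j(2) by (rule product_congruent)
    next
      case 4
      then obtain j where j: "j < q" "4 * int q dvd -1 + 4 * int j - r" using arc by blast
      have "\<exists>i<8*q. product i = E (-1 + 4 * int j + 4 * int q) e"
      proof (cases "Suc j < q")
        case lt: True
        then show ?thesis
          using product_between[of 2 j "2 * int j + 2 * int q - 1" False "2 * int j + 2 * int q" True] True
          by (simp add: block_entry_def algebra_simps)
      next
        case False
        note q = last[OF j(1) False]
        have eq: "4 * int q - 5 - (-1 + 4 * int j + 4 * int q) = - (4 * int q)"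
          using q by simp
        have "\<exists>i<8*q. product i = E (4 * int q - 5) e"
          using product_join[of 2 "4 * int q - 3" False "-2" True] pos_q True
          by (simp add: block_entry_def algebra_simps of_nat_diff)
        then show ?thesis
          by (rule product_congruent) (simp only: eq dvd_minus_iff dvd_refl)
      qed
      then have "\<exists>i<8*q. product i = E (-1 + 4 * int j) e"
        by (rule product_congruent) simp
      then show ?thesis using j(2) by (rule product_congruent)
    qed
  qed
qed

theorem harmonious: "harmonious G"
proof (rule harmoniousI)
  show "group G" by (rule is_group)
  show "order G = 8 * q" by (rule order)
  show "0 < 8 * q" using pos_q by simp
  show "g i \<in> carrier G" for i
    by (auto simp: g_def carrier split: prod.split)
  show "\<exists>i<8*q. g i = z" if "z \<in> carrier G" for z
    using that elements_attained by (auto simp: carrier)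
  show "\<exists>i<8*q. g i \<otimes> g (Suc i mod (8 * q)) = z" if "z \<in> carrier G" for z
    using that products_attained by (auto simp: carrier product_def)
qed

end

section \<open>Coordinates in a group generated by two elements\<close>

text \<open>
  The order is pinned down from two sides: the multiplication rule shows that the elements
  \<open>x\<^sup>r y\<^sup>e\<close> form a subgroup containing the generators, so that there are at most \<open>8q\<close> elements, and
  \<open>S\<close> witnesses that there are at least so many. Finiteness of the group is part of the conclusion,
  which is why the lower bound is not stated in terms of the order.
\<close>
lemma twisted_coordinatesI:
  fixes G (structure)
  assumes G: "group G" and x: "x \<in> carrier G" and y: "y \<in> carrier G"
    and q: "even q" "0 < q"
    and x_pow: "x [^] (4 * q) = \<one>" and y_pow: "y [^] (2::nat) = \<one>"
    and conj: "inv y \<otimes> x \<otimes> y = x [^] (2 * q + 1)"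
    and generated: "\<And>H. \<lbrakk>subgroup H G; x \<in> H; y \<in> H\<rbrakk> \<Longrightarrow> H = carrier G"
    and S: "S \<subseteq> carrier G" "card S = 8 * q"
  shows "twisted_coordinates G (\<lambda>(r::int) e. x [^] r \<otimes> (if e then y else \<one>)) q"
proof -
  interpret group G by (rule G)
  define E where "E = (\<lambda>(r::int) e. x [^] r \<otimes> (if e then y else \<one>))"
  have E_closed: "E r e \<in> carrier G" for r e using x y by (simp add: E_def)
  have x_period: "x [^] r = \<one>" if r: "4 * int q dvd r" for r :: int
  proof -
    obtain t where "r = int (4 * q) * t" using r by auto
    then have "x [^] r = (x [^] int (4 * q)) [^] t" by (simp only: int_pow_pow[OF x])
    then show ?thesis by (simp only: int_pow_int x_pow int_pow_one)
  qed
  have period: "x [^] r = x [^] s" if "4 * int q dvd r - s" for r s :: int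
  proof -
    have "x [^] r = x [^] (r - s) \<otimes> x [^] s" using x
      by (simp add: int_pow_mult[symmetric])
    then show ?thesis using x_period[OF that] x by simp
  qed
  have yy: "y \<otimes> y = \<one>" using y_pow y by (simp add: numeral_2_eq_2)
  then have inv_y: "inv y = y" using y by (simp add: inv_equality)
  have swap: "y \<otimes> x [^] s = x [^] (s + (if odd s then 2 * int q else 0)) \<otimes> y" for s :: int
  proof -
    define n where "n = nat (s mod (4 * int q))"
    have n: "int n = s mod (4 * int q)" using q by (simp add: n_def)
    have s_n: "4 * int q dvd s - int n" unfolding n by (simp add: minus_mod_eq_mult_div)
    have yx: "y \<otimes> x = x [^] (2 * q + 1) \<otimes> y"
    proof -
      have "y \<otimes> x = (y \<otimes> x) \<otimes> (y \<otimes> y)" using x y yy by simp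
      also have "\<dots> = (y \<otimes> x \<otimes> y) \<otimes> y" using x y
        by (simp only: m_assoc m_closed)
      finally show ?thesis using conj inv_y by simp
    qed
    have pow: "y \<otimes> x [^] n = x [^] ((2 * q + 1) * n) \<otimes> y" for n :: nat
    proof (induction n)
      case 0 then show ?case using y by simp
    next
      case (Suc n)
      have "y \<otimes> x [^] Suc n = (y \<otimes> x [^] n) \<otimes> x" using x y
        by (simp add: m_assoc)
      also have "\<dots> = x [^] ((2 * q + 1) * n) \<otimes> (y \<otimes> x)" using Suc x y
        by (simp add: m_assoc)
      also have "\<dots> = x [^] ((2 * q + 1) * n) \<otimes> x [^] (2 * q + 1) \<otimes> y"
        using yx x y by (simp add: m_assoc)
      also have "\<dots> = x [^] ((2 * q + 1) * Suc n) \<otimes> y"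
        using x by (simp only: nat_pow_mult mult_Suc_right add.commute)
      finally show ?case .
    qed
    have "x [^] s = x [^] n" using period[OF s_n] by (simp add: int_pow_int)
    then have "y \<otimes> x [^] s = x [^] ((2 * q + 1) * n) \<otimes> y" using pow by simp
    also have "x [^] ((2 * q + 1) * n) = x [^] (int ((2 * q + 1) * n))" by (simp only: int_pow_int)
    also have "\<dots> = x [^] (s + (if odd s then 2 * int q else 0))"
    proof (rule period)
      obtain k where "s - int n = 4 * int q * k" using s_n by (rule dvdE)
      then have k: "int n = s - 4 * int q * k" by simp
      have "int ((2 * q + 1) * n) - (s + (if odd s then 2 * int q else 0))
          = 2 * int q * (s - (if odd s then 1 else 0)) - 4 * int q * (k * (2 * int q + 1))"
        by (simp add: k algebra_simps)
      moreover have "4 * int q dvd 2 * int q * (s - (if odd s then 1 else 0))"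
      proof -
        have "2 dvd s - (if odd s then 1 else 0)" by simp
        then have "2 * int q * 2 dvd 2 * int q * (s - (if odd s then 1 else 0))"
          by (rule mult_dvd_mono[OF dvd_refl])
        then show ?thesis by simp
      qed
      ultimately show "4 * int q dvd int ((2 * q + 1) * n) - (s + (if odd s then 2 * int q else 0))"
        by (metis dvd_diff dvd_triv_left)
    qed
    finally show ?thesis .
  qed
  have mult: "E r e \<otimes> E s f = E (r + s + (if e \<and> odd s then 2 * int q else 0)) (e \<noteq> f)" for r s e f
  proof (cases e)
    case False
    then show ?thesis using x y by (simp add: E_def m_assoc[symmetric] int_pow_mult)
  next
    case True
    define t where "t = s + (if odd s then 2 * int q else 0)"
    have "E r e \<otimes> E s f = x [^] r \<otimes> (y \<otimes> x [^] s) \<otimes> (if f then y else \<one>)"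
      using True x y by (simp add: E_def m_assoc)
    also have "\<dots> = x [^] (r + t) \<otimes> (y \<otimes> (if f then y else \<one>))"
      using x y by (simp add: swap t_def m_assoc int_pow_mult)
    also have "\<dots> = E (r + t) (e \<noteq> f)" using True yy y by (simp add: E_def)
    finally show ?thesis using True by (simp add: t_def add.assoc)
  qed
  have E_period: "E r e = E s e" if "4 * int q dvd r - s" for r s e
    using period[OF that] by (simp add: E_def)
  have one: "E 0 False = \<one>" by (simp add: E_def)
  have E_inv: "\<exists>s f. inv (E r e) = E s f" for r e
  proof -
    have "E (- r + (if e \<and> odd r then 2 * int q else 0)) e \<otimes> E r e = \<one>"
    proof -
      have "E (- r + (if e \<and> odd r then 2 * int q else 0)) e \<otimes> E r e
          = E (if e \<and> odd r then 4 * int q else 0) False"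
        by (simp add: mult)
      also have "\<dots> = E 0 False" by (rule E_period) simp
      finally show ?thesis using one by simp
    qed
    then show ?thesis using inv_equality[OF _ E_closed E_closed] by blast
  qed
  have E_mult: "\<exists>t g. E r e \<otimes> E s f = E t g" for r s e f
    using mult by blast
  have "subgroup {E r e | r e. True} G"
    by (rule subgroupI) (auto simp: E_closed E_inv E_mult)
  moreover have "x = E 1 False" "y = E 0 True" using x y by (auto simp: E_def int_pow_1)
  ultimately have carr: "carrier G = {E r e | r e. True}"
    using generated[of "{E r e | r e. True}"] by blast
  have upper: "carrier G \<subseteq> case_prod E ` ({0..<4 * int q} \<times> UNIV)"
  proof
    fix z assume "z \<in> carrier G"
    then obtain r e where z: "z = E r e" using carr by auto
    have "E r e = E (r mod (4 * int q)) e" by (rule E_period) (simp add: minus_mod_eq_mult_div)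
    then show "z \<in> case_prod E ` ({0..<4 * int q} \<times> UNIV)"
      using z q by (intro image_eqI[of _ _ "(r mod (4 * int q), e)"]) auto
  qed
  then have fin: "finite (carrier G)" by (rule finite_subset) simp
  have "card (carrier G) \<le> card ({0..<4 * int q} \<times> (UNIV :: bool set))"
    using upper by (rule surj_card_le[rotated]) simp
  moreover have "8 * q \<le> card (carrier G)" using card_mono[OF fin S(1)] S(2) by simp
  ultimately have "order G = 8 * q"
    by (simp add: order_def card_cartesian_product)
  with G q carr mult E_period have "twisted_coordinates G E q"
    by (intro twisted_coordinates.intro twisted_coordinates_axioms.intro)
  then show ?thesis by (simp only: E_def)
qed

section \<open>Groups given by generators and relations\<close>

definition word_class :: "('g word \<times> 'g word) set \<Rightarrow> 'g word \<Rightarrow> 'g word set" where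
  "word_class R u = {w. pres_eq R u w}"

lemma word_class_eq_iff: "word_class R u = word_class R v \<longleftrightarrow> pres_eq R u v"
proof
  assume "word_class R u = word_class R v"
  then show "pres_eq R u v" using pres_eq.refl[of R v] by (auto simp: word_class_def)
next
  assume "pres_eq R u v"
  then show "word_class R u = word_class R v"
    unfolding word_class_def by (blast intro: pres_eq.trans pres_eq.sym)
qed

lemma carrier_presented_group: "carrier (presented_group R) = range (word_class R)"
  by (auto simp: presented_group_def quotient_def word_class_def Image_def)

lemma one_presented_group: "\<one>\<^bsub>presented_group R\<^esub> = word_class R []"
  by (simp add: presented_group_def word_class_def)

lemma mult_presented_group:
  "word_class R u \<otimes>\<^bsub>presented_group R\<^esub> word_class R v = word_class R (u @ v)"
proof -
  have "(\<exists>a. pres_eq R u a \<and> (\<exists>b. pres_eq R v b \<and> pres_eq R (a @ b) w)) \<longleftrightarrow> pres_eq R (u @ v) w" for w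
    by (meson pres_eq.refl pres_eq.trans pres_eq_append)
  then show ?thesis by (simp add: presented_group_def word_class_def)
qed

lemma pow_presented_group:
  "word_class R [a] [^]\<^bsub>presented_group R\<^esub> (k :: nat) = word_class R (replicate k a)"
proof (induction k)
  case 0 show ?case by (simp add: one_presented_group)
next
  case (Suc k)
  then show ?case by (simp add: mult_presented_group replicate_append_same)
qed

lemma inv_presented_group:
  "inv\<^bsub>presented_group R\<^esub> (word_class R [(a, b)]) = word_class R [(a, \<not> b)]"
proof -
  interpret group "presented_group R" by (rule group_presented_group)
  have "pres_eq R [(a, \<not> b), (a, b)] []"
    using pres_eq.cancel[of R "[]" a "\<not> b" "[]"] by simp
  then show ?thesis
    by (intro inv_equality)
      (auto simp: mult_presented_group one_presented_group carrier_presented_group word_class_eq_iff)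
qed

lemma presented_group_generated:
  assumes H: "subgroup H (presented_group R)"
    and gens: "\<And>a. word_class R [(a, True)] \<in> H"
  shows "H = carrier (presented_group R)"
proof -
  have letter: "word_class R [(a, b)] \<in> H" for a b
    using gens[of a] subgroup.m_inv_closed[OF H gens[of a]]
    by (cases b) (simp_all add: inv_presented_group)
  have "word_class R w \<in> H" for w
  proof (induction w)
    case Nil
    show ?case using subgroup.one_closed[OF H] by (simp add: one_presented_group)
  next
    case (Cons c w)
    obtain a b where "c = (a, b)" by force
    then show ?case
      using subgroup.m_closed[OF H letter[of a b] Cons.IH] by (simp add: mult_presented_group)
  qed
  then show ?thesis
    using subgroup.subset[OF H] by (auto simp: carrier_presented_group)
qed

section \<open>The modular relations and their normal forms\<close>

definition modular_relations :: "nat \<Rightarrow> (xy word \<times> xy word) set" where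
  "modular_relations q =
     {(replicate (4 * q) (X, True), []),
      (replicate 2 (Y, True), []),
      ([(Y, False), (X, True), (Y, True)], replicate (2 * q + 1) (X, True))}"

text \<open>
  Right multiplication by a letter, read off on the exponents of \<open>x\<^sup>r y\<^sup>e\<close>: moving \<open>x\<close> past \<open>y\<close> turns
  it into \<open>x\<^bsup>2q+1\<^esup>\<close>. Exponents are kept as integers, so that a letter and its inverse undo each
  other exactly and only the defining relations require a congruence modulo \<open>4q\<close>.
\<close>
fun letter_action :: "nat \<Rightarrow> xy \<times> bool \<Rightarrow> int \<times> bool \<Rightarrow> int \<times> bool" where
  "letter_action q (X, b) (r, e) =
     (r + (if b then 1 else -1) * (if e then 2 * int q + 1 else 1), e)"
| "letter_action q (Y, b) (r, e) = (r, \<not> e)"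

definition word_action :: "nat \<Rightarrow> xy word \<Rightarrow> int \<times> bool \<Rightarrow> int \<times> bool" where
  "word_action q w s = fold (letter_action q) w s"

lemma word_action_append [simp]: "word_action q (u @ v) s = word_action q v (word_action q u s)"
  by (simp add: word_action_def)

text \<open>
  The action commutes with left multiplication by powers of \<open>x\<close>; therefore it respects congruence
  of the first component.
\<close>
lemma word_action_shift:
  "word_action q w (r + d, e) = map_prod (\<lambda>r. r + d) id (word_action q w (r, e))"
proof (induction w arbitrary: r e)
  case Nil show ?case by (simp add: word_action_def)
next
  case (Cons c w)
  obtain a b where c: "c = (a, b)" by force
  have "letter_action q c (r + d, e) = map_prod (\<lambda>r. r + d) id (letter_action q c (r, e))"
    unfolding c by (cases a) simp_all
  moreover obtain r' e' where "letter_action q c (r, e) = (r', e')" by force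
  ultimately show ?case using Cons.IH[of r' e'] by (simp add: word_action_def)
qed

lemma word_action_replicate:
  "word_action q (replicate k (X, True)) (r, e) = (r + int k * (if e then 2 * int q + 1 else 1), e)"
  by (induction k arbitrary: r) (simp_all add: word_action_def algebra_simps)

definition state_cong :: "nat \<Rightarrow> int \<times> bool \<Rightarrow> int \<times> bool \<Rightarrow> bool" where
  "state_cong q s t \<longleftrightarrow> 4 * int q dvd fst s - fst t \<and> snd s = snd t"

lemma state_cong_refl: "state_cong q s s"
  by (simp add: state_cong_def)

lemma state_cong_sym: "state_cong q s t \<Longrightarrow> state_cong q t s"
  by (auto simp: state_cong_def dvd_diff_commute)

lemma state_cong_trans: "state_cong q s t \<Longrightarrow> state_cong q t u \<Longrightarrow> state_cong q s u"
  unfolding state_cong_def using dvd_add[of "4 * int q" "fst s - fst t" "fst t - fst u"] by simp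

lemma state_cong_word_action:
  assumes "state_cong q s t"
  shows "state_cong q (word_action q w s) (word_action q w t)"
proof -
  have s: "s = (fst t + (fst s - fst t), snd t)"
    using assms by (simp add: state_cong_def prod_eq_iff)
  have "word_action q w s = map_prod (\<lambda>r. r + (fst s - fst t)) id (word_action q w t)"
    by (subst s, subst word_action_shift) simp
  then show ?thesis using assms by (simp add: state_cong_def)
qed

text \<open>
  The third relation is the one with content: on states with \<open>e\<close> true it amounts to
  \<open>(2q + 1)\<^sup>2 \<equiv> 1\<close> modulo \<open>4q\<close>.
\<close>
lemma relation_action:
  assumes "(u, v) \<in> modular_relations q"
  shows "state_cong q (word_action q u s) (word_action q v s)"
proof -
  obtain r e where s: "s = (r, e)" by force
  have Nil: "word_action q [] t = t" for t by (simp add: word_action_def)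
  from assms consider "u = replicate (4 * q) (X, True)" "v = []"
    | "u = replicate 2 (Y, True)" "v = []"
    | "u = [(Y, False), (X, True), (Y, True)]" "v = replicate (2 * q + 1) (X, True)"
    unfolding modular_relations_def by blast
  then show ?thesis
  proof cases
    case 1
    then show ?thesis unfolding 1 Nil s word_action_replicate by (simp add: state_cong_def)
  next
    case 2
    then show ?thesis by (simp add: s state_cong_def word_action_def numeral_2_eq_2)
  next
    case 3
    have "1 - (1 + 2 * int q) * (2 * int q + 1) = 4 * int q * (- (int q + 1))"
      by (simp add: algebra_simps)
    then have "4 * int q dvd 1 - (1 + 2 * int q) * (2 * int q + 1)" by (rule dvdI)
    then show ?thesis unfolding 3 s word_action_replicate
      by (simp add: state_cong_def word_action_def)
  qed
qed

lemma pres_eq_action: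
  "pres_eq (modular_relations q) u v \<Longrightarrow> state_cong q (word_action q u s) (word_action q v s)"
proof (induction arbitrary: s rule: pres_eq.induct)
  case (refl u) show ?case by (rule state_cong_refl)
next
  case (sym u v) show ?case using sym.IH by (rule state_cong_sym)
next
  case (trans u v w) show ?case using trans.IH by (rule state_cong_trans)
next
  case (cancel u a b v)
  obtain r e where "word_action q u s = (r, e)" by force
  then have "word_action q [(a, b), (a, \<not> b)] (word_action q u s) = word_action q u s"
    by (cases a) (simp_all add: word_action_def)
  then show ?case by (simp add: state_cong_refl del: append_Cons)
next
  case (relation l r u v)
  then show ?case by (simp add: state_cong_word_action relation_action)
qed

lemma normal_words_distinct:
  "inj_on (\<lambda>(r, e). word_class (modular_relations q)
           (replicate r (X, True) @ (if e then [(Y, True)] else []))) ({..<4 * q} \<times> UNIV)"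
    (is "inj_on ?c _")
proof (rule inj_onI, clarify)
  fix r s :: nat and e f :: bool
  assume less: "r < 4 * q" "s < 4 * q"
  assume "word_class (modular_relations q) (replicate r (X, True) @ (if e then [(Y, True)] else []))
    = word_class (modular_relations q) (replicate s (X, True) @ (if f then [(Y, True)] else []))"
  then have "state_cong q
      (word_action q (replicate r (X, True) @ (if e then [(Y, True)] else [])) (0, False))
      (word_action q (replicate s (X, True) @ (if f then [(Y, True)] else [])) (0, False))"
    unfolding word_class_eq_iff by (rule pres_eq_action)
  moreover have "word_action q (replicate k (X, True) @ (if d then [(Y, True)] else [])) (0, False)
      = (int k, d)" for k d
    by (simp add: word_action_replicate) (simp add: word_action_def)
  ultimately have "int (4 * q) dvd int r - int s" "e = f" by (simp_all add: state_cong_def)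
  then have "int r mod int (4 * q) = int s mod int (4 * q)" by (simp only: mod_eq_dvd_iff)
  then have "r = s" using less by (metis mod_less of_nat_eq_iff zmod_int)
  with \<open>e = f\<close> show "r = s \<and> e = f" by simp
qed

theorem mainTheorem6:
  fixes n :: nat
  assumes "n \<ge> 4"
  shows "harmonious (modular_2_group n)"
proof -
  define q :: nat where "q = 2 ^ (n - 3)"
  let ?R = "modular_relations q"
  obtain k where k: "n = k + 4" using assms by (metis add.commute le_Suc_ex)
  have q: "even q" "0 < q" "2 ^ (n - 1) = 4 * q" "2 ^ (n - 2) = 2 * q"
    by (simp_all add: q_def k power_add)
  have G: "modular_2_group n = presented_group ?R"
    by (simp only: modular_2_group_def modular_relations_def q(3,4))
  define x where "x = word_class ?R [(X, True)]"
  define y where "y = word_class ?R [(Y, True)]"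
  have rel: "word_class ?R u = word_class ?R v" if "(u, v) \<in> ?R" for u v
    using pres_eq.relation[OF that, of "[]" "[]"] by (simp add: word_class_eq_iff)
  have "twisted_coordinates (presented_group ?R)
      (\<lambda>r e. x [^]\<^bsub>presented_group ?R\<^esub> (r :: int) \<otimes>\<^bsub>presented_group ?R\<^esub>
        (if e then y else \<one>\<^bsub>presented_group ?R\<^esub>)) q"
  proof (rule twisted_coordinatesI)
    show "group (presented_group ?R)" by (rule group_presented_group)
    show "x \<in> carrier (presented_group ?R)" "y \<in> carrier (presented_group ?R)"
      by (simp_all add: x_def y_def carrier_presented_group)
    show "x [^]\<^bsub>presented_group ?R\<^esub> (4 * q) = \<one>\<^bsub>presented_group ?R\<^esub>"
      unfolding x_def pow_presented_group one_presented_group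
      by (rule rel) (simp add: modular_relations_def)
    show "y [^]\<^bsub>presented_group ?R\<^esub> (2 :: nat) = \<one>\<^bsub>presented_group ?R\<^esub>"
      unfolding y_def pow_presented_group one_presented_group
      by (rule rel) (simp add: modular_relations_def)
    have "word_class ?R [(Y, False), (X, True), (Y, True)]
        = word_class ?R (replicate (2 * q + 1) (X, True))"
      by (rule rel) (simp add: modular_relations_def)
    then show "inv\<^bsub>presented_group ?R\<^esub> y \<otimes>\<^bsub>presented_group ?R\<^esub> x \<otimes>\<^bsub>presented_group ?R\<^esub> y
        = x [^]\<^bsub>presented_group ?R\<^esub> (2 * q + 1)"
      unfolding x_def y_def pow_presented_group inv_presented_group
      by (simp add: mult_presented_group)
    show "H = carrier (presented_group ?R)"
      if H: "subgroup H (presented_group ?R)" "x \<in> H" "y \<in> H" for H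
    proof (rule presented_group_generated[OF H(1)])
      fix a show "word_class ?R [(a, True)] \<in> H"
        using H(2,3) by (cases a) (simp_all add: x_def y_def)
    qed
    let ?S = "(\<lambda>(r, e). word_class ?R (replicate r (X, True) @ (if e then [(Y, True)] else [])))
      ` ({..<4 * q} \<times> UNIV)"
    show "?S \<subseteq> carrier (presented_group ?R)"
      by (auto simp: carrier_presented_group)
    show "card ?S = 8 * q"
      using card_image[OF normal_words_distinct[of q]] by (simp add: card_cartesian_product)
  qed (use q in auto)
  then show ?thesis unfolding G by (rule twisted_coordinates.harmonious)
qed

end
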